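(* Let $n\ge 2$ and $m\ge 0$ be integers and let $\alpha_0\neq 0$. The second-order linear differential equation $$\Big(\sum_{k=0}^{n}\alpha_k r^k\Big)y''(r)+\Big(\sum_{k=0}^{n-1}\beta_k r^k\Big)y'(r)-\Big(\sum_{k=0}^{n-2}\tau_k r^k\Big)y(r)=0$$ admits the solution $y(r)=\mathcal{P}_m(r)=\sum_{i=0}^{m}\mathcal{C}_i r^i$, a polynomial of degree $m$, in the neighbourhood of the ordinary point $r=0$ and valid up to the nearest nonzero singular point (zero of $\sum_{k=0}^{n}\alpha_k r^k$), if $$\sum_{j=0}^{n}\Big[\alpha_{n-j}(\ell-n+j+2)(\ell-n+j+1)+\beta_{n-j-1}(\ell-n+j+2)-\tau_{n-j-2}\Big]\,\mathcal{C}_{\ell-n+j+2}=0$$ for all $\ell=0,1,2,\ldots,m+n-2$. Moreover, the equation corresponding to $\ell=m+n-2$ gives the necessary condition for the existence of the degree-$m$ polynomial solution, $$\tau_{n-2}=\alpha_n\,m(m-1)+\beta_{n-1}\,m .$$ The remaining $m+n-2$ linear equations consist of $n-2$ sufficient conditions that relate $\{\alpha_k\}_{k=0}^{n}$ and $\{\beta_k\}_{k=0}^{n-1}$ with $\{\tau_k\}_{k=0}^{n-2}$, in addition to the $m$ linear equations required to evaluate the coefficients $\{\mathcal{C}_i\}_{i=1}^{m}$ of the polynomial solution in terms of $\mathcal{C}_0\ne 0$.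
   Context: The coefficients $\alpha_k,\beta_k,\tau_k$ and $\mathcal{C}_i$ are constants (real or complex numbers). Conventions: $\tau_i=\beta_i=0$ if $i<0$; $\mathcal{C}_i=0$ if $i<0$ or $i>m$; and $\mathcal{C}_m\neq 0$ since $\mathcal{P}_m$ has degree $m$. In the paper's use of the result, among the remaining equations $\ell=0,\ldots,m+n-3$, the $m$ equations with $\ell=0,\ldots,m-1$ are those used to evaluate $\mathcal{C}_1,\ldots,\mathcal{C}_m$, and the $n-2$ equations with $\ell=m,\ldots,m+n-3$ give the sufficient conditions.
   Formalization: That the m equations evaluate C_1,...,C_m from C_0≠0 is stated only when their matrix is nonsingular, shown equivalent to unique solvability (it fails for y''=0, n=2, m=1); the n-2 conditions with C_i eliminated also assume this and that the resulting C_m is nonzero. *)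

theory Defs
  imports
    "HOL-Analysis.Analysis"
    "HOL-Computational_Algebra.Polynomial"
    "Jordan_Normal_Form.Determinant"
begin

text \<open>
  The coefficients live in an arbitrary \<open>real_normed_field\<close>, which covers the real and the complex
  numbers. The equation is given by the sequences \<open>\<alpha>\<close>, \<open>\<beta>\<close>, \<open>\<tau>\<close>, of which only the entries
  with index at most \<open>n\<close>, \<open>n - 1\<close>, \<open>n - 2\<close> respectively are used.
\<close>

definition leading_coeff_fun :: "nat \<Rightarrow> (nat \<Rightarrow> 'a) \<Rightarrow> 'a \<Rightarrow> 'a::real_normed_field" where
  "leading_coeff_fun n \<alpha> r = (\<Sum>k=0..n. \<alpha> k * r ^ k)"

definition ode_solution_on ::
  "nat \<Rightarrow> (nat \<Rightarrow> 'a) \<Rightarrow> (nat \<Rightarrow> 'a) \<Rightarrow> (nat \<Rightarrow> 'a) \<Rightarrow> 'a set \<Rightarrow> ('a \<Rightarrow> 'a::real_normed_field) \<Rightarrow> bool" where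
  "ode_solution_on n \<alpha> \<beta> \<tau> S y \<longleftrightarrow>
     (\<forall>r\<in>S. y field_differentiable at r \<and> deriv y field_differentiable at r \<and>
        leading_coeff_fun n \<alpha> r * deriv (deriv y) r
        + (\<Sum>k=0..n-1. \<beta> k * r ^ k) * deriv y r
        - (\<Sum>k=0..n-2. \<tau> k * r ^ k) * y r = 0)"

text \<open>
  The disc about \<open>0\<close> reaching up to the nearest singular point, and the whole field if there is no
  singular point.
\<close>

definition regular_disc :: "nat \<Rightarrow> (nat \<Rightarrow> 'a) \<Rightarrow> 'a::real_normed_field set" where
  "regular_disc n \<alpha> = {r. \<forall>z. leading_coeff_fun n \<alpha> z = 0 \<longrightarrow> norm r < norm z}"

text \<open>The convention that coefficients with an index outside \<open>{0..d}\<close> vanish.\<close>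

definition zero_ext :: "nat \<Rightarrow> (nat \<Rightarrow> 'a) \<Rightarrow> int \<Rightarrow> 'a::zero" where
  "zero_ext d f i = (if 0 \<le> i \<and> i \<le> int d then f (nat i) else 0)"

text \<open>The left-hand side of the \<open>l\<close>-th linear equation for the coefficients \<open>C 0, \<dots>, C m\<close>.\<close>

definition rec_lhs ::
  "nat \<Rightarrow> nat \<Rightarrow> (nat \<Rightarrow> 'a) \<Rightarrow> (nat \<Rightarrow> 'a) \<Rightarrow> (nat \<Rightarrow> 'a) \<Rightarrow> (nat \<Rightarrow> 'a) \<Rightarrow> nat \<Rightarrow> 'a::real_normed_field" where
  "rec_lhs n m \<alpha> \<beta> \<tau> C l =
     (\<Sum>j=0..n.
        (zero_ext n \<alpha> (int n - int j)
           * of_int (int l - int n + int j + 2) * of_int (int l - int n + int j + 1)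
         + zero_ext (n - 1) \<beta> (int n - int j - 1) * of_int (int l - int n + int j + 2)
         - zero_ext (n - 2) \<tau> (int n - int j - 2))
        * zero_ext m C (int l - int n + int j + 2))"

text \<open>The coefficient of the unknown \<open>C i\<close> in the \<open>l\<close>-th equation.\<close>

definition rec_coeff ::
  "nat \<Rightarrow> nat \<Rightarrow> (nat \<Rightarrow> 'a) \<Rightarrow> (nat \<Rightarrow> 'a) \<Rightarrow> (nat \<Rightarrow> 'a) \<Rightarrow> nat \<Rightarrow> nat \<Rightarrow> 'a::real_normed_field" where
  "rec_coeff n m \<alpha> \<beta> \<tau> l i = rec_lhs n m \<alpha> \<beta> \<tau> (\<lambda>k. if k = i then 1 else 0) l"

text \<open>
  The matrix of the equations \<open>l = 0, \<dots>, m - 1\<close> in the unknowns \<open>C 1, \<dots>, C m\<close>: column \<open>i\<close>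
  belongs to \<open>C (Suc i)\<close>.
\<close>

definition eval_mat ::
  "nat \<Rightarrow> nat \<Rightarrow> (nat \<Rightarrow> 'a) \<Rightarrow> (nat \<Rightarrow> 'a) \<Rightarrow> (nat \<Rightarrow> 'a) \<Rightarrow> 'a::real_normed_field Matrix.mat" where
  "eval_mat n m \<alpha> \<beta> \<tau> = Matrix.mat m m (\<lambda>(l, i). rec_coeff n m \<alpha> \<beta> \<tau> l (Suc i))"

text \<open>
  Cramer's rule for these equations with \<open>C 0 = 1\<close>, so that the \<open>C 0\<close>-terms form the right-hand
  side. It is meaningful when the matrix is nonsingular, and it depends on \<open>\<alpha>\<close>, \<open>\<beta>\<close>, \<open>\<tau>\<close> only.
\<close>

definition eval_coeff ::
  "nat \<Rightarrow> nat \<Rightarrow> (nat \<Rightarrow> 'a) \<Rightarrow> (nat \<Rightarrow> 'a) \<Rightarrow> (nat \<Rightarrow> 'a) \<Rightarrow> nat \<Rightarrow> 'a::real_normed_field" where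
  "eval_coeff n m \<alpha> \<beta> \<tau> i =
     (if i = 0 then 1
      else Determinant.det
             (replace_col (eval_mat n m \<alpha> \<beta> \<tau>)
                (Matrix.vec m (\<lambda>l. - rec_coeff n m \<alpha> \<beta> \<tau> l 0)) (i - 1))
           / Determinant.det (eval_mat n m \<alpha> \<beta> \<tau>))"

end

theory Submission
  imports Defs
begin

text \<open>
  Write \<open>A = \<Sum> \<alpha>\<^sub>k x^k\<close>, \<open>B = \<Sum> \<beta>\<^sub>k x^k\<close>, \<open>T = \<Sum> \<tau>\<^sub>k x^k\<close>. For a polynomial \<open>p\<close> the left-hand side of
  the differential equation is the value of the polynomial \<open>A p'' + B p' - T p\<close>, and the \<open>l\<close>-th
  recurrence expression is its coefficient of \<open>x^l\<close>, as soon as \<open>degree p \<le> m\<close>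
  (\<open>coeff_ode_poly\<close>). A polynomial vanishing on a nonempty open set is zero, so \<open>p\<close> solves the
  equation near one point if and only if all these coefficients vanish, and it then solves the
  equation everywhere. By degree, only the coefficients with \<open>l \<le> m + n - 2\<close> can be nonzero. In the
  top one just one summand survives, namely
  \<open>(\<alpha>\<^sub>n m (m - 1) + \<beta>\<^sub>n\<^sub>-\<^sub>1 m - \<tau>\<^sub>n\<^sub>-\<^sub>2) C\<^sub>m\<close> with \<open>C\<^sub>m \<noteq> 0\<close> (\<open>rec_lhs_top\<close>); this is the condition on
  \<open>\<tau>\<^sub>n\<^sub>-\<^sub>2\<close>.

  The expressions are linear in \<open>C\<close>. The equations \<open>l < m\<close> therefore say that the vector
  \<open>(C\<^sub>1, \<dots>, C\<^sub>m)\<close> is mapped by the evaluation matrix to \<open>C\<^sub>0\<close> times a fixed right-hand side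
  (\<open>rec_lhs_as_system\<close>). A nonsingular matrix gives the unique solution by Cramer's rule
  (\<open>rec_lhs_zero_iff_cramer\<close>), whereas adding a kernel vector of a singular matrix to a solution
  gives another solution with the same \<open>C\<^sub>0\<close>.
\<close>

section \<open>The differential operator on polynomials\<close>

definition coeff_poly :: "nat \<Rightarrow> (nat \<Rightarrow> 'a) \<Rightarrow> 'a::comm_monoid_add poly" where
  "coeff_poly d f = (\<Sum>k=0..d. Polynomial.monom (f k) k)"

lemma coeff_coeff_poly: "coeff (coeff_poly d f) i = (if i \<le> d then f i else 0)"
  by (auto simp: coeff_poly_def coeff_sum sum.delta')

lemma degree_coeff_poly: "degree (coeff_poly d f) \<le> d"
  by (rule degree_le) (simp add: coeff_coeff_poly)

lemma poly_coeff_poly: "poly (coeff_poly d f) r = (\<Sum>k=0..d. f k * r ^ k)"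
  for r :: "'a::comm_semiring_1"
  by (simp add: coeff_poly_def poly_sum poly_monom)

lemma coeff_coeff_poly_mult:
  "coeff (coeff_poly d f * q) l = (\<Sum>k=0..d. f k * (if k \<le> l then coeff q (l - k) else 0))"
  for q :: "'a::comm_semiring_1 poly"
  unfolding coeff_poly_def sum_distrib_right coeff_sum
  by (rule sum.cong) (auto simp: coeff_monom_mult)

definition ode_poly ::
  "nat \<Rightarrow> (nat \<Rightarrow> 'a) \<Rightarrow> (nat \<Rightarrow> 'a) \<Rightarrow> (nat \<Rightarrow> 'a) \<Rightarrow> 'a poly \<Rightarrow> 'a::real_normed_field poly" where
  "ode_poly n \<alpha> \<beta> \<tau> p =
     coeff_poly n \<alpha> * pderiv (pderiv p) + coeff_poly (n - 1) \<beta> * pderiv p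
       - coeff_poly (n - 2) \<tau> * p"

lemma deriv_poly: "deriv (poly p) = poly (pderiv p)" for p :: "'a::real_normed_field poly"
  by (rule ext, rule DERIV_imp_deriv, rule poly_DERIV)

lemma ode_solution_on_poly_iff:
  "ode_solution_on n \<alpha> \<beta> \<tau> S (poly p) \<longleftrightarrow> (\<forall>r\<in>S. poly (ode_poly n \<alpha> \<beta> \<tau> p) r = 0)"
proof -
  have diff: "poly q field_differentiable at r" for q :: "'a poly" and r
    using poly_DERIV field_differentiable_def by blast
  show ?thesis
    by (simp add: ode_solution_on_def deriv_poly diff ode_poly_def poly_coeff_poly
        leading_coeff_fun_def)
qed

text \<open>A nonempty open set is infinite because no point of the field is isolated.\<close>

lemma poly_zero_on_open_imp_zero:
  fixes q :: "'a::real_normed_field poly"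
  assumes "open U" and "x \<in> U" and zero: "\<And>r. r \<in> U \<Longrightarrow> poly q r = 0"
  shows "q = 0"
proof (rule ccontr)
  assume "q \<noteq> 0"
  then have "finite {r. poly q r = 0}"
    by (rule poly_roots_finite)
  then have "finite U"
    by (rule rev_finite_subset) (use zero in blast)
  then have "open (U - (U - {x}))"
    using \<open>open U\<close> by (intro open_Diff finite_imp_closed) auto
  moreover have "U - (U - {x}) = {x}"
    using \<open>x \<in> U\<close> by blast
  ultimately show False
    by (simp add: not_open_singleton)
qed

section \<open>The recurrence expressions as coefficients\<close>

lemma zero_ext_neg: "e < 0 \<Longrightarrow> zero_ext d f e = 0"
  by (simp add: zero_ext_def)

lemma zero_ext_of_nat: "zero_ext d f (int i) = (if i \<le> d then f i else 0)"
  by (simp add: zero_ext_def)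

lemma zero_ext_coeff: "degree p \<le> m \<Longrightarrow> zero_ext m (coeff p) (int i) = coeff p i"
  by (auto simp: zero_ext_of_nat coeff_eq_0)

text \<open>
  Summing over \<open>k = n - j\<close> makes each summand the contribution of \<open>\<alpha>\<^sub>k\<close>, \<open>\<beta>\<^sub>k\<^sub>-\<^sub>1\<close>, \<open>\<tau>\<^sub>k\<^sub>-\<^sub>2\<close> to one power
  of \<open>x\<close>.
\<close>

lemma rec_lhs_by_index:
  "rec_lhs n m \<alpha> \<beta> \<tau> C l =
     (\<Sum>k=0..n.
        (zero_ext n \<alpha> (int k) * of_int (int l - int k + 2) * of_int (int l - int k + 1)
         + zero_ext (n - 1) \<beta> (int k - 1) * of_int (int l - int k + 2)
         - zero_ext (n - 2) \<tau> (int k - 2)) * zero_ext m C (int l - int k + 2))"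
  unfolding rec_lhs_def
  by (subst (2) sum.atLeastAtMost_rev, rule sum.cong) (auto simp: of_nat_diff algebra_simps)

text \<open>
  The \<open>k\<close>-th terms of the three products need index shifts by \<open>2\<close>, \<open>1\<close>, \<open>0\<close>. For \<open>k > l\<close> a product
  has no such term, and in the recurrence either the index of \<open>p\<close> is negative or a factor that stems
  from differentiating vanishes.
\<close>

lemma coeff_ode_poly:
  assumes "n \<ge> 2" and deg: "degree p \<le> m"
  shows "coeff (ode_poly n \<alpha> \<beta> \<tau> p) l = rec_lhs n m \<alpha> \<beta> \<tau> (coeff p) l"
proof -
  obtain N where n: "n = Suc (Suc N)"
    using \<open>n \<ge> 2\<close> by (metis add_2_eq_Suc le_Suc_ex)
  let ?z = "zero_ext m (coeff p)"
  have shift2: "of_int (int l - int k + 2) * of_int (int l - int k + 1) * ?z (int l - int k + 2)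
      = (if k \<le> l then coeff (pderiv (pderiv p)) (l - k) else 0)" for k
  proof (cases "k \<le> l")
    case True
    then obtain d where d: "l = k + d"
      using le_Suc_ex by blast
    have "int d + 2 = int (d + 2)"
      by simp
    then have "?z (int d + 2) = coeff p (d + 2)"
      using zero_ext_coeff[OF deg] by metis
    then show ?thesis
      by (simp add: d coeff_pderiv algebra_simps)
  next
    case False
    then consider "k = l + 1" | "k = l + 2" | "int l - int k + 2 < 0"
      by linarith
    then show ?thesis
      by cases (auto simp: zero_ext_neg)
  qed
  have shift1: "of_int (int l - int k + 1) * ?z (int l - int k + 1)
      = (if k \<le> l then coeff (pderiv p) (l - k) else 0)" for k
  proof (cases "k \<le> l")
    case True
    then obtain d where d: "l = k + d"
      using le_Suc_ex by blast
    have "int d + 1 = int (d + 1)"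
      by simp
    then have "?z (int d + 1) = coeff p (d + 1)"
      using zero_ext_coeff[OF deg] by metis
    then show ?thesis
      by (simp add: d coeff_pderiv algebra_simps)
  next
    case False
    then consider "k = l + 1" | "int l - int k + 1 < 0"
      by linarith
    then show ?thesis
      by cases (auto simp: zero_ext_neg)
  qed
  have shift0: "?z (int l - int k) = (if k \<le> l then coeff p (l - k) else 0)" for k
    using zero_ext_coeff[OF deg, of "l - k"] by (auto simp: zero_ext_neg of_nat_diff)
  have "rec_lhs n m \<alpha> \<beta> \<tau> (coeff p) l =
      (\<Sum>k=0..n. zero_ext n \<alpha> (int k) * (of_int (int l - int k + 2)
          * of_int (int l - int k + 1) * ?z (int l - int k + 2)))
      + (\<Sum>k=0..n. zero_ext (n - 1) \<beta> (int k - 1)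
          * (of_int (int l - int k + 2) * ?z (int l - int k + 2)))
      - (\<Sum>k=0..n. zero_ext (n - 2) \<tau> (int k - 2) * ?z (int l - int k + 2))"
    unfolding rec_lhs_by_index sum.distrib[symmetric] sum_subtractf[symmetric]
    by (rule sum.cong) (simp_all add: algebra_simps)
  also have "(\<Sum>k=0..n. zero_ext n \<alpha> (int k) * (of_int (int l - int k + 2)
          * of_int (int l - int k + 1) * ?z (int l - int k + 2)))
      = coeff (coeff_poly n \<alpha> * pderiv (pderiv p)) l"
    unfolding shift2 coeff_coeff_poly_mult
    by (rule sum.cong) (auto simp: zero_ext_of_nat)
  also have "(\<Sum>k=0..n. zero_ext (n - 1) \<beta> (int k - 1)
          * (of_int (int l - int k + 2) * ?z (int l - int k + 2)))
      = (\<Sum>k=0..n - 1. zero_ext (n - 1) \<beta> (int k)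
          * (of_int (int l - int k + 1) * ?z (int l - int k + 1)))"
    unfolding n by (subst sum.atLeast0_atMost_Suc_shift) (simp add: zero_ext_neg algebra_simps)
  also have "\<dots> = coeff (coeff_poly (n - 1) \<beta> * pderiv p) l"
    unfolding shift1 coeff_coeff_poly_mult
    by (rule sum.cong) (auto simp: zero_ext_of_nat)
  also have "(\<Sum>k=0..n. zero_ext (n - 2) \<tau> (int k - 2) * ?z (int l - int k + 2))
      = (\<Sum>k=0..n - 2. zero_ext (n - 2) \<tau> (int k) * ?z (int l - int k))"
    unfolding n
    by (subst sum.atLeast0_atMost_Suc_shift, subst sum.atLeast0_atMost_Suc_shift)
       (simp add: zero_ext_neg algebra_simps)
  also have "\<dots> = coeff (coeff_poly (n - 2) \<tau> * p) l"
    unfolding shift0 coeff_coeff_poly_mult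
    by (rule sum.cong) (auto simp: zero_ext_of_nat)
  finally show ?thesis
    by (simp add: ode_poly_def)
qed

lemma rec_lhs_above_top:
  assumes "n \<ge> 2" and "l > m + n - 2"
  shows "rec_lhs n m \<alpha> \<beta> \<tau> C l = 0"
  unfolding rec_lhs_def using assms by (intro sum.neutral) (auto simp: zero_ext_def)

text \<open>The summand \<open>j\<close> contains \<open>C\<^sub>m\<^sub>+\<^sub>j\<close>, which vanishes for \<open>j > 0\<close>.\<close>

lemma rec_lhs_top:
  assumes "n \<ge> 2"
  shows "rec_lhs n m \<alpha> \<beta> \<tau> C (m + n - 2) =
    (\<alpha> n * of_nat m * (of_nat m - 1) + \<beta> (n - 1) * of_nat m - \<tau> (n - 2)) * C m"
proof -
  have l: "int (m + n - 2) = int m + int n - 2"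
    using assms by simp
  have idx: "zero_ext (n - 1) \<beta> (int n - 1) = \<beta> (n - 1)" "zero_ext (n - 2) \<tau> (int n - 2) = \<tau> (n - 2)"
    using assms zero_ext_of_nat[of "n - 1" \<beta> "n - 1"] zero_ext_of_nat[of "n - 2" \<tau> "n - 2"]
    by (simp_all add: of_nat_diff)
  have "rec_lhs n m \<alpha> \<beta> \<tau> C (m + n - 2) =
      (\<Sum>j=0..n. if j = 0 then
        (\<alpha> n * of_nat m * (of_nat m - 1) + \<beta> (n - 1) * of_nat m - \<tau> (n - 2)) * C m else 0)"
    unfolding rec_lhs_def l
  proof (rule sum.cong)
    fix j assume "j \<in> {0..n}"
    have "zero_ext m C (int m + int n - 2 - int n + int j + 2) = (if j = 0 then C m else 0)"
      by (auto simp: zero_ext_def)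
    then show "(zero_ext n \<alpha> (int n - int j)
        * of_int (int m + int n - 2 - int n + int j + 2)
        * of_int (int m + int n - 2 - int n + int j + 1)
        + zero_ext (n - 1) \<beta> (int n - int j - 1) * of_int (int m + int n - 2 - int n + int j + 2)
        - zero_ext (n - 2) \<tau> (int n - int j - 2))
        * zero_ext m C (int m + int n - 2 - int n + int j + 2) =
      (if j = 0 then
        (\<alpha> n * of_nat m * (of_nat m - 1) + \<beta> (n - 1) * of_nat m - \<tau> (n - 2)) * C m else 0)"
      by (cases "j = 0") (simp_all add: idx zero_ext_of_nat del: One_nat_def)
  qed simp
  then show ?thesis
    by simp
qed

lemma rec_lhs_top_eq_0_iff:
  assumes "n \<ge> 2" and "C m \<noteq> 0"
  shows "rec_lhs n m \<alpha> \<beta> \<tau> C (m + n - 2) = 0 \<longleftrightarrow>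
    \<tau> (n - 2) = \<alpha> n * of_nat m * (of_nat m - 1) + \<beta> (n - 1) * of_nat m"
  using assms by (auto simp: rec_lhs_top)

section \<open>Polynomial solutions\<close>

lemma ode_solution_poly:
  assumes "n \<ge> 2" and "degree p \<le> m" and "\<forall>l\<in>{0..m+n-2}. rec_lhs n m \<alpha> \<beta> \<tau> (coeff p) l = 0"
  shows "ode_solution_on n \<alpha> \<beta> \<tau> S (poly p)"
proof -
  have "coeff (ode_poly n \<alpha> \<beta> \<tau> p) l = 0" for l
    using assms rec_lhs_above_top[OF \<open>n \<ge> 2\<close>, of m l \<alpha> \<beta> \<tau> "coeff p"]
    by (cases "l \<le> m + n - 2") (simp_all add: coeff_ode_poly)
  then have "ode_poly n \<alpha> \<beta> \<tau> p = 0"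
    by (simp add: poly_eq_iff)
  then show ?thesis
    by (simp add: ode_solution_on_poly_iff)
qed

lemma rec_lhs_eq_0_of_ode_solution:
  assumes "n \<ge> 2" and "degree p \<le> m" and "open U" and "x \<in> U"
    and "ode_solution_on n \<alpha> \<beta> \<tau> U (poly p)"
  shows "rec_lhs n m \<alpha> \<beta> \<tau> (coeff p) l = 0"
proof -
  have "ode_poly n \<alpha> \<beta> \<tau> p = 0"
    using assms poly_zero_on_open_imp_zero[of U x "ode_poly n \<alpha> \<beta> \<tau> p"]
    by (simp add: ode_solution_on_poly_iff)
  then show ?thesis
    using coeff_ode_poly[OF \<open>n \<ge> 2\<close> \<open>degree p \<le> m\<close>, of \<alpha> \<beta> \<tau> l] by simp
qed

text \<open>The leading coefficient function has finitely many zeros, so the disc is a finite intersection of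
  open sets.\<close>

lemma open_regular_disc:
  assumes "\<alpha> 0 \<noteq> 0"
  shows "open (regular_disc n \<alpha>)"
proof -
  have eq: "leading_coeff_fun n \<alpha> z = poly (coeff_poly n \<alpha>) z" for z
    by (simp add: leading_coeff_fun_def poly_coeff_poly)
  have "coeff (coeff_poly n \<alpha>) 0 \<noteq> 0"
    using assms by (simp add: coeff_coeff_poly)
  then have "finite {z. poly (coeff_poly n \<alpha>) z = 0}"
    by (intro poly_roots_finite) auto
  moreover have "regular_disc n \<alpha> = (\<Inter>z\<in>{z. poly (coeff_poly n \<alpha>) z = 0}. ball 0 (norm z))"
    by (auto simp: regular_disc_def eq)
  ultimately show ?thesis
    by (auto intro: open_INT)
qed

lemma zero_in_regular_disc:
  assumes "\<alpha> 0 \<noteq> 0"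
  shows "0 \<in> regular_disc n \<alpha>"
proof -
  have "leading_coeff_fun n \<alpha> 0 = \<alpha> 0"
    by (simp add: leading_coeff_fun_def)
  then show ?thesis
    using assms by (auto simp: regular_disc_def)
qed

section \<open>The linear system for the coefficients\<close>

lemma zero_ext_linear_combination:
  "zero_ext m C e = (\<Sum>i=0..m. zero_ext m (\<lambda>k. if k = i then 1 else 0) e * C i)"
  for C :: "nat \<Rightarrow> 'a::comm_semiring_1"
proof (cases "0 \<le> e \<and> e \<le> int m")
  case True
  then have "(\<Sum>i=0..m. zero_ext m (\<lambda>k. if k = i then 1 else 0) e * C i)
      = (\<Sum>i=0..m. if nat e = i then C i else 0)"
    by (intro sum.cong) (auto simp: zero_ext_def)
  also have "\<dots> = C (nat e)"
    using True by (simp add: nat_le_iff)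
  finally show ?thesis
    using True by (simp add: zero_ext_def)
qed (auto simp: zero_ext_def)

lemma rec_lhs_linear: "rec_lhs n m \<alpha> \<beta> \<tau> C l = (\<Sum>i=0..m. rec_coeff n m \<alpha> \<beta> \<tau> l i * C i)"
  unfolding rec_coeff_def rec_lhs_def sum_distrib_right
  by (subst zero_ext_linear_combination) (simp only: sum_distrib_left mult.assoc, rule sum.swap)

lemma rec_lhs_cong:
  "(\<And>i. i \<le> m \<Longrightarrow> C i = D i) \<Longrightarrow> rec_lhs n m \<alpha> \<beta> \<tau> C l = rec_lhs n m \<alpha> \<beta> \<tau> D l"
  by (simp add: rec_lhs_linear)

lemma rec_lhs_scale: "rec_lhs n m \<alpha> \<beta> \<tau> (\<lambda>i. c * C i) l = c * rec_lhs n m \<alpha> \<beta> \<tau> C l"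
  by (simp add: rec_lhs_linear sum_distrib_left mult.left_commute)

lemma rec_lhs_as_system:
  fixes C :: "nat \<Rightarrow> 'a::real_normed_field"
  assumes "l < m"
  shows "rec_lhs n m \<alpha> \<beta> \<tau> C l =
    vec_index (eval_mat n m \<alpha> \<beta> \<tau> *\<^sub>v Matrix.vec m (\<lambda>i. C (Suc i))) l
      + rec_coeff n m \<alpha> \<beta> \<tau> l 0 * C 0"
proof -
  have split: "(\<Sum>i=0..m. g i) = g 0 + (\<Sum>i=0..<m. g (Suc i))" for g :: "nat \<Rightarrow> 'a"
    using sum.atLeast0_lessThan_Suc_shift[of g m]
    by (simp only: atLeastLessThanSuc_atLeastAtMost comp_def)
  have "vec_index (eval_mat n m \<alpha> \<beta> \<tau> *\<^sub>v Matrix.vec m (\<lambda>i. C (Suc i))) l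
      = (\<Sum>i=0..<m. rec_coeff n m \<alpha> \<beta> \<tau> l (Suc i) * C (Suc i))"
    using assms by (simp add: eval_mat_def scalar_prod_def)
  then show ?thesis
    unfolding rec_lhs_linear split by simp
qed

text \<open>Existence of a solution, by the adjugate, turns Cramer's formula into a characterization.\<close>

lemma mult_mat_vec_eq_iff_cramer:
  fixes A :: "'a::field Matrix.mat"
  assumes A: "A \<in> carrier_mat n n" and det: "Determinant.det A \<noteq> 0"
    and v: "v \<in> carrier_vec n" and b: "b \<in> carrier_vec n"
  shows "A *\<^sub>v v = b \<longleftrightarrow>
    (\<forall>i<n. vec_index v i = Determinant.det (replace_col A b i) / Determinant.det A)"
proof -
  have cramer: "vec_index x i = Determinant.det (replace_col A b i) / Determinant.det A"
    if "x \<in> carrier_vec n" "A *\<^sub>v x = b" "i < n" for x i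
    using cramer_lemma_mat[OF A that(1,3)] that(2) det by simp
  define x where "x = adj_mat A *\<^sub>v ((1 / Determinant.det A) \<cdot>\<^sub>v b)"
  have x: "x \<in> carrier_vec n"
    using adj_mat(1)[OF A] b by (simp add: x_def)
  have "A *\<^sub>v x = (A * adj_mat A) *\<^sub>v ((1 / Determinant.det A) \<cdot>\<^sub>v b)"
    unfolding x_def using A adj_mat(1)[OF A] b by (intro assoc_mult_mat_vec[symmetric]) auto
  also have "\<dots> = b"
    unfolding adj_mat(2)[OF A] using b det
    by (intro eq_vecI) (auto simp: scalar_prod_def row_def if_distrib[of "\<lambda>c. _ * c * _"]
        simp flip: sum_divide_distrib cong: if_cong)
  finally have Ax: "A *\<^sub>v x = b" .
  show ?thesis
  proof
    assume "\<forall>i<n. vec_index v i = Determinant.det (replace_col A b i) / Determinant.det A"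
    then have "v = x"
      using cramer[OF x Ax] v x by (intro eq_vecI) auto
    then show "A *\<^sub>v v = b"
      using Ax by simp
  qed (use cramer v in blast)
qed

lemma eval_mat_carrier: "eval_mat n m \<alpha> \<beta> \<tau> \<in> carrier_mat m m"
  by (simp add: eval_mat_def)

lemma eval_coeff_0: "eval_coeff n m \<alpha> \<beta> \<tau> 0 = 1"
  by (simp add: eval_coeff_def)

text \<open>By homogeneity it suffices to treat \<open>C\<^sub>0 = 1\<close>, the normalization in Cramer's rule.\<close>

lemma rec_lhs_zero_iff_cramer:
  assumes det: "Determinant.det (eval_mat n m \<alpha> \<beta> \<tau>) \<noteq> 0" and "C 0 \<noteq> 0"
  shows "(\<forall>l\<in>{0..<m}. rec_lhs n m \<alpha> \<beta> \<tau> C l = 0) \<longleftrightarrow>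
    (\<forall>i\<in>{1..m}. C i = C 0 * eval_coeff n m \<alpha> \<beta> \<tau> i)"
proof -
  let ?A = "eval_mat n m \<alpha> \<beta> \<tau>"
  let ?b = "Matrix.vec m (\<lambda>l. - rec_coeff n m \<alpha> \<beta> \<tau> l 0)"
  define D where "D = (\<lambda>i. C i / C 0)"
  let ?v = "Matrix.vec m (\<lambda>i. D (Suc i))"
  have C: "C = (\<lambda>i. C 0 * D i)" and D0: "D 0 = 1"
    using \<open>C 0 \<noteq> 0\<close> by (auto simp: D_def)
  have "rec_lhs n m \<alpha> \<beta> \<tau> C l = C 0 * rec_lhs n m \<alpha> \<beta> \<tau> D l" for l
    by (subst C) (rule rec_lhs_scale)
  then have "(\<forall>l\<in>{0..<m}. rec_lhs n m \<alpha> \<beta> \<tau> C l = 0)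
      \<longleftrightarrow> (\<forall>l<m. rec_lhs n m \<alpha> \<beta> \<tau> D l = 0)"
    using \<open>C 0 \<noteq> 0\<close> by auto
  also have "\<dots> \<longleftrightarrow> (\<forall>l<m. vec_index (?A *\<^sub>v ?v) l = vec_index ?b l)"
    by (auto simp: rec_lhs_as_system D0 eq_neg_iff_add_eq_0 simp del: index_mult_mat_vec)
  also have "\<dots> \<longleftrightarrow> ?A *\<^sub>v ?v = ?b"
    using eval_mat_carrier[of n m \<alpha> \<beta> \<tau>] by (auto simp: vec_eq_iff simp del: index_mult_mat_vec)
  also have "\<dots> \<longleftrightarrow> (\<forall>i<m. D (Suc i) = eval_coeff n m \<alpha> \<beta> \<tau> (Suc i))"
    by (subst mult_mat_vec_eq_iff_cramer[OF eval_mat_carrier det]) (auto simp: eval_coeff_def)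
  also have "\<dots> \<longleftrightarrow> (\<forall>i\<in>{1..m}. D i = eval_coeff n m \<alpha> \<beta> \<tau> i)"
    by (metis One_nat_def Suc_le_eq Suc_le_D atLeastAtMost_iff
        not_less_eq_eq zero_less_Suc)
  also have "\<dots> \<longleftrightarrow> (\<forall>i\<in>{1..m}. C i = C 0 * eval_coeff n m \<alpha> \<beta> \<tau> i)"
    using \<open>C 0 \<noteq> 0\<close> by (simp add: D_def field_simps)
  finally show ?thesis .
qed

lemma rec_lhs_zero_scaled_eval_coeff:
  assumes "Determinant.det (eval_mat n m \<alpha> \<beta> \<tau>) \<noteq> 0" and "c \<noteq> 0" and "l < m"
  shows "rec_lhs n m \<alpha> \<beta> \<tau> (\<lambda>i. c * eval_coeff n m \<alpha> \<beta> \<tau> i) l = 0"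
  using assms rec_lhs_zero_iff_cramer[OF assms(1), where C = "\<lambda>i. c * eval_coeff n m \<alpha> \<beta> \<tau> i"]
  by (simp add: eval_coeff_0)

text \<open>A kernel vector of a singular evaluation matrix gives a nonzero solution with \<open>C\<^sub>0 = 0\<close>, which
  can be added to any other solution.\<close>

lemma singular_imp_homogeneous_solution:
  assumes "Determinant.det (eval_mat n m \<alpha> \<beta> \<tau>) = 0"
  obtains q where "degree q \<le> m" and "coeff q 0 = 0" and "q \<noteq> 0"
    and "\<And>l. l < m \<Longrightarrow> rec_lhs n m \<alpha> \<beta> \<tau> (coeff q) l = 0"
proof -
  obtain v where v: "v \<in> carrier_vec m" "v \<noteq> 0\<^sub>v m" "eval_mat n m \<alpha> \<beta> \<tau> *\<^sub>v v = 0\<^sub>v m"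
    using assms det_0_iff_vec_prod_zero_field[OF eval_mat_carrier] by metis
  define q where "q = coeff_poly m (\<lambda>i. if i = 0 then 0 else vec_index v (i - 1))"
  have coeff_q: "coeff q (Suc i) = vec_index v i" if "i < m" for i
    using that by (simp add: q_def coeff_coeff_poly)
  have q0: "coeff q 0 = 0"
    by (simp add: q_def coeff_coeff_poly)
  have vec: "Matrix.vec m (\<lambda>i. coeff q (Suc i)) = v"
    using v(1) coeff_q by (intro eq_vecI) auto
  have "rec_lhs n m \<alpha> \<beta> \<tau> (coeff q) l = 0" if "l < m" for l
    using that by (simp add: rec_lhs_as_system vec v(3) q0 del: index_mult_mat_vec)
  moreover have "q \<noteq> 0"
  proof
    assume "q = 0"
    then have "v = 0\<^sub>v m"
      using coeff_q v(1) by (intro eq_vecI) auto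
    then show False
      using v(2) by contradiction
  qed
  moreover have "degree q \<le> m"
    by (simp add: q_def degree_coeff_poly)
  ultimately show ?thesis
    using q0 that by blast
qed

lemma rec_lhs_coeff_add:
  "rec_lhs n m \<alpha> \<beta> \<tau> (coeff (p + q)) l =
     rec_lhs n m \<alpha> \<beta> \<tau> (coeff p) l + rec_lhs n m \<alpha> \<beta> \<tau> (coeff q) l"
  by (simp add: rec_lhs_linear distrib_left sum.distrib)

lemma nonsingular_iff_unique_solution:
  "Determinant.det (eval_mat n m \<alpha> \<beta> \<tau>) \<noteq> 0 \<longleftrightarrow>
     (\<forall>c. c \<noteq> 0 \<longrightarrow> (\<exists>!p :: 'a::real_normed_field poly. degree p \<le> m \<and> coeff p 0 = c
        \<and> (\<forall>l\<in>{0..<m}. rec_lhs n m \<alpha> \<beta> \<tau> (coeff p) l = 0)))"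
  (is "?nonsing \<longleftrightarrow> (\<forall>c. c \<noteq> 0 \<longrightarrow> (\<exists>!p. ?sol c p))")
proof
  assume det: ?nonsing
  show "\<forall>c. c \<noteq> 0 \<longrightarrow> (\<exists>!p. ?sol c p)"
  proof (intro allI impI)
    fix c :: 'a assume c: "c \<noteq> 0"
    define p where "p = coeff_poly m (\<lambda>i. c * eval_coeff n m \<alpha> \<beta> \<tau> i)"
    have coeffs: "coeff p i = c * eval_coeff n m \<alpha> \<beta> \<tau> i" if "i \<le> m" for i
      using that by (simp add: p_def coeff_coeff_poly)
    have "rec_lhs n m \<alpha> \<beta> \<tau> (coeff p) l = 0" if "l < m" for l
      using rec_lhs_zero_scaled_eval_coeff[OF det c that]
        rec_lhs_cong[of m "coeff p" "\<lambda>i. c * eval_coeff n m \<alpha> \<beta> \<tau> i" n \<alpha> \<beta> \<tau> l] coeffs by simp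
    then have "?sol c p"
      by (simp add: coeffs eval_coeff_0) (simp add: p_def degree_coeff_poly)
    moreover have "q = p" if q: "?sol c q" for q
    proof (rule poly_eqI)
      fix i
      have "\<forall>i\<in>{1..m}. coeff q i = coeff q 0 * eval_coeff n m \<alpha> \<beta> \<tau> i"
        using q c rec_lhs_zero_iff_cramer[OF det, of "coeff q"] by auto
      then show "coeff q i = coeff p i"
        using q by (cases "i = 0"; cases "i \<le> m")
          (auto simp: coeffs eval_coeff_0 coeff_eq_0 p_def coeff_coeff_poly)
    qed
    ultimately show "\<exists>!p. ?sol c p"
      by blast
  qed
next
  assume unique: "\<forall>c. c \<noteq> 0 \<longrightarrow> (\<exists>!p. ?sol c p)"
  show ?nonsing
  proof
    assume "Determinant.det (eval_mat n m \<alpha> \<beta> \<tau>) = 0"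
    then obtain q where q: "degree q \<le> m" "coeff q 0 = 0" "q \<noteq> 0"
      "\<And>l. l < m \<Longrightarrow> rec_lhs n m \<alpha> \<beta> \<tau> (coeff q) l = 0"
      using singular_imp_homogeneous_solution by blast
    have ex1: "\<exists>!p. ?sol 1 p"
      using unique by simp
    then obtain p where p: "?sol 1 p"
      by blast
    have "?sol 1 (p + q)"
      using p q by (auto simp: rec_lhs_coeff_add degree_add_le)
    with p ex1 have "p + q = p"
      by blast
    with q(3) show False
      by simp
  qed
qed

section \<open>The criterion\<close>

text \<open>The equations split into the \<open>m\<close> that determine the coefficients, the \<open>n - 2\<close> compatibility
  conditions, and the top one, which the value of \<open>\<tau>\<^sub>n\<^sub>-\<^sub>2\<close> takes care of.\<close>

lemma rec_lhs_zero_if_split: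
  assumes "n \<ge> 2" and "\<tau> (n-2) = \<alpha> n * of_nat m * (of_nat m - 1) + \<beta> (n-1) * of_nat m"
    and "\<forall>l\<in>{0..<m}. rec_lhs n m \<alpha> \<beta> \<tau> C l = 0"
    and "\<forall>l\<in>{m..<m+n-2}. rec_lhs n m \<alpha> \<beta> \<tau> C l = 0" and "l \<le> m + n - 2"
  shows "rec_lhs n m \<alpha> \<beta> \<tau> C l = 0"
proof -
  consider "l < m" | "m \<le> l" "l < m + n - 2" | "l = m + n - 2"
    using \<open>l \<le> m + n - 2\<close> by linarith
  then show ?thesis
    by cases (use assms in \<open>auto simp: rec_lhs_top\<close>)
qed

theorem theorem4p1:
  fixes n m :: nat and \<alpha> \<beta> \<tau> :: "nat \<Rightarrow> 'a::real_normed_field"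
  assumes "n \<ge> 2" and "\<alpha> 0 \<noteq> 0"
  shows
    "open (regular_disc n \<alpha>) \<and> 0 \<in> regular_disc n \<alpha>
     \<and> (\<forall>p :: 'a poly. p \<noteq> 0 \<and> degree p = m
           \<and> (\<forall>l\<in>{0..m+n-2}. rec_lhs n m \<alpha> \<beta> \<tau> (coeff p) l = 0)
         \<longrightarrow> ode_solution_on n \<alpha> \<beta> \<tau> (regular_disc n \<alpha>) (poly p))
     \<and> (\<forall>p :: 'a poly. p \<noteq> 0 \<and> degree p = m \<longrightarrow>
           (rec_lhs n m \<alpha> \<beta> \<tau> (coeff p) (m+n-2) = 0
              \<longleftrightarrow> \<tau> (n-2) = \<alpha> n * of_nat m * (of_nat m - 1) + \<beta> (n-1) * of_nat m))
     \<and> ((\<exists>(p :: 'a poly) U. p \<noteq> 0 \<and> degree p = m \<and> open U \<and> 0 \<in> U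
            \<and> ode_solution_on n \<alpha> \<beta> \<tau> U (poly p))
         \<longrightarrow> \<tau> (n-2) = \<alpha> n * of_nat m * (of_nat m - 1) + \<beta> (n-1) * of_nat m)
     \<and> ({0..m+n-2} - {m+n-2} = {0..<m} \<union> {m..<m+n-2} \<and> {0..<m} \<inter> {m..<m+n-2} = {}
         \<and> card {0..<m} = m \<and> card {m..<m+n-2} = n-2)
     \<and> (\<forall>C l. rec_lhs n m \<alpha> \<beta> \<tau> C l = (\<Sum>i=0..m. rec_coeff n m \<alpha> \<beta> \<tau> l i * C i))
     \<and> (Determinant.det (eval_mat n m \<alpha> \<beta> \<tau>) \<noteq> 0 \<longleftrightarrow>
         (\<forall>c. c \<noteq> 0 \<longrightarrow> (\<exists>!p :: 'a poly. degree p \<le> m \<and> coeff p 0 = c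
            \<and> (\<forall>l\<in>{0..<m}. rec_lhs n m \<alpha> \<beta> \<tau> (coeff p) l = 0))))
     \<and> (Determinant.det (eval_mat n m \<alpha> \<beta> \<tau>) \<noteq> 0 \<longrightarrow>
         (\<forall>p :: 'a poly. degree p \<le> m \<and> coeff p 0 \<noteq> 0 \<longrightarrow>
            ((\<forall>l\<in>{0..<m}. rec_lhs n m \<alpha> \<beta> \<tau> (coeff p) l = 0)
              \<longleftrightarrow> (\<forall>i\<in>{1..m}. coeff p i = coeff p 0 * eval_coeff n m \<alpha> \<beta> \<tau> i))))
     \<and> (\<forall>p :: 'a poly. p \<noteq> 0 \<and> degree p = m
           \<and> \<tau> (n-2) = \<alpha> n * of_nat m * (of_nat m - 1) + \<beta> (n-1) * of_nat m
           \<and> (\<forall>l\<in>{0..<m}. rec_lhs n m \<alpha> \<beta> \<tau> (coeff p) l = 0)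
           \<and> (\<forall>l\<in>{m..<m+n-2}. rec_lhs n m \<alpha> \<beta> \<tau> (coeff p) l = 0)
         \<longrightarrow> ode_solution_on n \<alpha> \<beta> \<tau> (regular_disc n \<alpha>) (poly p))
     \<and> (Determinant.det (eval_mat n m \<alpha> \<beta> \<tau>) \<noteq> 0 \<and> eval_coeff n m \<alpha> \<beta> \<tau> m \<noteq> 0
           \<and> \<tau> (n-2) = \<alpha> n * of_nat m * (of_nat m - 1) + \<beta> (n-1) * of_nat m
           \<and> (\<forall>l\<in>{m..<m+n-2}. rec_lhs n m \<alpha> \<beta> \<tau> (eval_coeff n m \<alpha> \<beta> \<tau>) l = 0)
         \<longrightarrow> (\<forall>c. c \<noteq> 0 \<longrightarrow> (\<exists>p :: 'a poly. p \<noteq> 0 \<and> degree p = m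
              \<and> (\<forall>i\<in>{0..m}. coeff p i = c * eval_coeff n m \<alpha> \<beta> \<tau> i)
              \<and> ode_solution_on n \<alpha> \<beta> \<tau> (regular_disc n \<alpha>) (poly p))))"
proof (intro conjI allI impI)
  show "open (regular_disc n \<alpha>)" "0 \<in> regular_disc n \<alpha>"
    using assms by (simp_all add: open_regular_disc zero_in_regular_disc)
next
  fix p :: "'a poly"
  assume "p \<noteq> 0 \<and> degree p = m \<and> (\<forall>l\<in>{0..m+n-2}. rec_lhs n m \<alpha> \<beta> \<tau> (coeff p) l = 0)"
  then show "ode_solution_on n \<alpha> \<beta> \<tau> (regular_disc n \<alpha>) (poly p)"
    using \<open>n \<ge> 2\<close> by (intro ode_solution_poly) auto
next
  fix p :: "'a poly"
  assume "p \<noteq> 0 \<and> degree p = m"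
  then show "rec_lhs n m \<alpha> \<beta> \<tau> (coeff p) (m+n-2) = 0 \<longleftrightarrow>
      \<tau> (n-2) = \<alpha> n * of_nat m * (of_nat m - 1) + \<beta> (n-1) * of_nat m"
    using \<open>n \<ge> 2\<close> by (intro rec_lhs_top_eq_0_iff) auto
next
  assume "\<exists>(p :: 'a poly) U. p \<noteq> 0 \<and> degree p = m \<and> open U \<and> 0 \<in> U
    \<and> ode_solution_on n \<alpha> \<beta> \<tau> U (poly p)"
  then obtain p :: "'a poly" and U where p: "p \<noteq> 0" "degree p = m" "open U" "0 \<in> U"
    "ode_solution_on n \<alpha> \<beta> \<tau> U (poly p)"
    by blast
  then have "rec_lhs n m \<alpha> \<beta> \<tau> (coeff p) (m+n-2) = 0"
    using \<open>n \<ge> 2\<close> by (intro rec_lhs_eq_0_of_ode_solution[of n p m U 0]) auto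
  moreover have "coeff p m \<noteq> 0"
    using p by auto
  ultimately show "\<tau> (n-2) = \<alpha> n * of_nat m * (of_nat m - 1) + \<beta> (n-1) * of_nat m"
    using rec_lhs_top_eq_0_iff[OF \<open>n \<ge> 2\<close>] by blast
next
  show "{0..m+n-2} - {m+n-2} = {0..<m} \<union> {m..<m+n-2}" "{0..<m} \<inter> {m..<m+n-2} = {}"
    "card {0..<m} = m" "card {m..<m+n-2} = n-2"
    using \<open>n \<ge> 2\<close> by auto
next
  fix C l
  show "rec_lhs n m \<alpha> \<beta> \<tau> C l = (\<Sum>i=0..m. rec_coeff n m \<alpha> \<beta> \<tau> l i * C i)"
    by (rule rec_lhs_linear)
next
  show "Determinant.det (eval_mat n m \<alpha> \<beta> \<tau>) \<noteq> 0 \<longleftrightarrow>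
      (\<forall>c. c \<noteq> 0 \<longrightarrow> (\<exists>!p :: 'a poly. degree p \<le> m \<and> coeff p 0 = c
         \<and> (\<forall>l\<in>{0..<m}. rec_lhs n m \<alpha> \<beta> \<tau> (coeff p) l = 0)))"
    by (rule nonsingular_iff_unique_solution)
next
  fix p :: "'a poly"
  assume "Determinant.det (eval_mat n m \<alpha> \<beta> \<tau>) \<noteq> 0" and "degree p \<le> m \<and> coeff p 0 \<noteq> 0"
  then show "(\<forall>l\<in>{0..<m}. rec_lhs n m \<alpha> \<beta> \<tau> (coeff p) l = 0) \<longleftrightarrow>
      (\<forall>i\<in>{1..m}. coeff p i = coeff p 0 * eval_coeff n m \<alpha> \<beta> \<tau> i)"
    by (intro rec_lhs_zero_iff_cramer) auto
next
  fix p :: "'a poly"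
  assume p: "p \<noteq> 0 \<and> degree p = m
    \<and> \<tau> (n-2) = \<alpha> n * of_nat m * (of_nat m - 1) + \<beta> (n-1) * of_nat m
    \<and> (\<forall>l\<in>{0..<m}. rec_lhs n m \<alpha> \<beta> \<tau> (coeff p) l = 0)
    \<and> (\<forall>l\<in>{m..<m+n-2}. rec_lhs n m \<alpha> \<beta> \<tau> (coeff p) l = 0)"
  then have "rec_lhs n m \<alpha> \<beta> \<tau> (coeff p) l = 0" if "l \<le> m + n - 2" for l
    using p that \<open>n \<ge> 2\<close> by (intro rec_lhs_zero_if_split) auto
  then show "ode_solution_on n \<alpha> \<beta> \<tau> (regular_disc n \<alpha>) (poly p)"
    using p \<open>n \<ge> 2\<close> by (intro ode_solution_poly) auto
next
  fix c :: 'a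
  let ?e = "eval_coeff n m \<alpha> \<beta> \<tau>"
  assume hyp: "Determinant.det (eval_mat n m \<alpha> \<beta> \<tau>) \<noteq> 0 \<and> ?e m \<noteq> 0
      \<and> \<tau> (n-2) = \<alpha> n * of_nat m * (of_nat m - 1) + \<beta> (n-1) * of_nat m
      \<and> (\<forall>l\<in>{m..<m+n-2}. rec_lhs n m \<alpha> \<beta> \<tau> ?e l = 0)"
    and c: "c \<noteq> 0"
  define p where "p = coeff_poly m (\<lambda>i. c * ?e i)"
  have coeffs: "coeff p i = c * ?e i" if "i \<le> m" for i
    using that by (simp add: p_def coeff_coeff_poly)
  have "coeff p m \<noteq> 0"
    using hyp c by (simp add: coeffs)
  then have p: "p \<noteq> 0" "degree p = m"
    using degree_coeff_poly[of m "\<lambda>i. c * ?e i"] le_degree[of p m] by (auto simp: p_def)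
  have eqs: "rec_lhs n m \<alpha> \<beta> \<tau> (coeff p) l = c * rec_lhs n m \<alpha> \<beta> \<tau> ?e l" for l
    using rec_lhs_cong[of m "coeff p" "\<lambda>i. c * ?e i" n \<alpha> \<beta> \<tau> l] coeffs
    by (simp add: rec_lhs_scale)
  have "rec_lhs n m \<alpha> \<beta> \<tau> ?e l = 0" if "l < m" for l
    using rec_lhs_zero_scaled_eval_coeff[of n m \<alpha> \<beta> \<tau> 1 l] hyp that by simp
  then have "rec_lhs n m \<alpha> \<beta> \<tau> ?e l = 0" if "l \<le> m + n - 2" for l
    using hyp that \<open>n \<ge> 2\<close> by (intro rec_lhs_zero_if_split) auto
  then have "ode_solution_on n \<alpha> \<beta> \<tau> (regular_disc n \<alpha>) (poly p)"
    using p \<open>n \<ge> 2\<close> by (intro ode_solution_poly[where m = m]) (simp_all add: eqs)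
  with p coeffs show "\<exists>p :: 'a poly. p \<noteq> 0 \<and> degree p = m
      \<and> (\<forall>i\<in>{0..m}. coeff p i = c * ?e i)
      \<and> ode_solution_on n \<alpha> \<beta> \<tau> (regular_disc n \<alpha>) (poly p)"
    by (intro exI[of _ p]) auto
qed

end
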